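(* Let $\mathcal{H}$ be a Hilbert space with orthonormal basis $\{e_n\}_{n\ge0}$, let $H_0$ be the self-adjoint operator with $H_0e_n=ne_n$ for all $n\ge 0$, let $T$ be a bounded operator on $\mathcal{H}$ with bounded inverse, put $\varphi_n=Te_n$, and let $\beta>0$. Let $$\omega_{\varphi\varphi}(X)=\frac{1}{Z_{\varphi\varphi}}\sum_{n\ge0}e^{-\beta n}\langle\varphi_n,X\varphi_n\rangle,\qquad Z_{\varphi\varphi}=\sum_{n\ge0}e^{-\beta n}\|\varphi_n\|^2 .$$ For $B\in B(\mathcal{H})$ let $B_T:=(TT^* )^{-1}B(TT^* )$. Then for all $A,B\in B(\mathcal{H})$ $$\omega_{\varphi\varphi}\big(A\,\alpha_\varphi^{i\beta}(B)\big)=\omega_{\varphi\varphi}(B_TA).$$ In particular, if $B$ commutes with $TT^*$, then $\omega_{\varphi\varphi}(BA)=\omega_{\varphi\varphi}\big(A\,\alpha_\varphi^{i\beta}(B)\big)$.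
   Context: $B(\mathcal{H})$ is the algebra of bounded operators on $\mathcal{H}$; the inner product is linear in the second variable. For $t\in\mathbb{R}$ and $X\in B(\mathcal{H})$, $\alpha_0^t(X)=e^{iH_0t}Xe^{-iH_0t}$ and $\alpha_\varphi^t(X)=T\alpha_0^t(T^{-1}XT)T^{-1}$. At the imaginary time $t=i\beta$ the same formulas are used, i.e. $\alpha_\varphi^{i\beta}(B)=Te^{-\beta H_0}T^{-1}BTe^{\beta H_0}T^{-1}$, a possibly unbounded operator which is defined at least on the linear span of $\{\varphi_n\}$. The functional $\omega_{\varphi\varphi}$ is applied to any (possibly unbounded) operator $X$ whose domain contains all $\varphi_n$ and for which the defining series converges absolutely; part of the claim is that this is so for $X=A\,\alpha_\varphi^{i\beta}(B)$. *)

theory Defs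
  imports "HOL-Analysis.Analysis"
begin

class chilbert_space = banach +
  fixes scaleC :: "complex \<Rightarrow> 'a \<Rightarrow> 'a"  (infixr \<open>*\<^sub>C\<close> 75)
    and cinner :: "'a \<Rightarrow> 'a \<Rightarrow> complex"
  assumes scaleC_add_right: "a *\<^sub>C (x + y) = a *\<^sub>C x + a *\<^sub>C y"
    and scaleC_add_left: "(a + b) *\<^sub>C x = a *\<^sub>C x + b *\<^sub>C x"
    and scaleC_scaleC: "a *\<^sub>C b *\<^sub>C x = (a * b) *\<^sub>C x"
    and scaleC_one: "1 *\<^sub>C x = x"
    and scaleR_scaleC: "scaleR r x = complex_of_real r *\<^sub>C x"
    and cinner_commute: "cinner x y = cnj (cinner y x)"
    and cinner_add_right: "cinner x (y + z) = cinner x y + cinner x z"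
    and cinner_scaleC_right: "cinner x (a *\<^sub>C y) = a * cinner x y"
    and cinner_self: "cinner x x = complex_of_real ((norm x)\<^sup>2)"

interpretation complex_vector:
  vector_space "scaleC :: complex \<Rightarrow> 'a \<Rightarrow> 'a::chilbert_space"
  by unfold_locales (simp_all add: scaleC_add_right scaleC_add_left scaleC_scaleC scaleC_one)

definition orthonormal_basis :: "(nat \<Rightarrow> 'h::chilbert_space) \<Rightarrow> bool" where
  "orthonormal_basis e \<longleftrightarrow>
     (\<forall>m n. cinner (e m) (e n) = (if m = n then 1 else 0)) \<and>
     closure (complex_vector.span (range e)) = UNIV"

definition bounded_clinear :: "('h::chilbert_space \<Rightarrow> 'h) \<Rightarrow> bool" where
  "bounded_clinear f \<longleftrightarrow> bounded_linear f \<and> (\<forall>c x. f (c *\<^sub>C x) = c *\<^sub>C f x)"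

definition cadjoint :: "('h::chilbert_space \<Rightarrow> 'h) \<Rightarrow> 'h \<Rightarrow> 'h" where
  "cadjoint f x = (THE z. \<forall>u. cinner z u = cinner x (f u))"

text \<open>A possibly unbounded operator is a partial function \<open>'h \<rightharpoonup> 'h\<close> with domain
  \<^const>\<open>dom\<close>. The product of operators is \<^const>\<open>map_comp\<close>, so that a product is defined
  exactly where all its stages are; \<open>total_op\<close> embeds the everywhere defined operators.\<close>

definition total_op :: "('h \<Rightarrow> 'h) \<Rightarrow> 'h \<rightharpoonup> 'h" where
  "total_op f = (\<lambda>x. Some (f x))"

definition linear_op :: "('h::chilbert_space \<rightharpoonup> 'h) \<Rightarrow> bool" where
  "linear_op H \<longleftrightarrow> complex_vector.subspace (dom H) \<and>
     (\<forall>x\<in>dom H. \<forall>y\<in>dom H. the (H (x + y)) = the (H x) + the (H y)) \<and>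
     (\<forall>c. \<forall>x\<in>dom H. the (H (c *\<^sub>C x)) = c *\<^sub>C the (H x))"

definition adj_op :: "('h::chilbert_space \<rightharpoonup> 'h) \<Rightarrow> 'h \<rightharpoonup> 'h" where
  "adj_op H x =
     (if \<exists>z. \<forall>u\<in>dom H. cinner z u = cinner x (the (H u))
      then Some (THE z. \<forall>u\<in>dom H. cinner z u = cinner x (the (H u))) else None)"

definition self_adjoint :: "('h::chilbert_space \<rightharpoonup> 'h) \<Rightarrow> bool" where
  "self_adjoint H \<longleftrightarrow> linear_op H \<and> closure (dom H) = UNIV \<and> adj_op H = H"

definition eigenspace :: "('h::chilbert_space \<rightharpoonup> 'h) \<Rightarrow> real \<Rightarrow> 'h set" where
  "eigenspace H l = {x. H x = Some (complex_of_real l *\<^sub>C x)}"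

definition eigenprojection :: "('h::chilbert_space \<rightharpoonup> 'h) \<Rightarrow> real \<Rightarrow> 'h \<Rightarrow> 'h" where
  "eigenprojection H l x =
     (THE y. y \<in> eigenspace H l \<and> (\<forall>z\<in>eigenspace H l. cinner z (x - y) = 0))"

text \<open>If the self-adjoint operator \<open>H\<close> has an orthonormal basis of eigenvectors, its spectral
  measure is the sum of the point masses \<open>eigenprojection H l\<close> at the eigenvalues \<open>l\<close>. For such
  \<open>H\<close> the following is therefore the usual functional calculus \<open>f(H)\<close>, with its natural domain
  (all \<open>x\<close> for which \<open>f\<close> is square integrable with respect to the spectral measure of \<open>H\<close> at
  \<open>x\<close>). It is not meant for operators with continuous spectrum. The projections vanish at all
  \<open>l\<close> that are not eigenvalues.\<close>

definition fun_calculus ::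
    "(real \<Rightarrow> complex) \<Rightarrow> ('h::chilbert_space \<rightharpoonup> 'h) \<Rightarrow> 'h \<rightharpoonup> 'h" where
  "fun_calculus f H x =
     (if (\<lambda>l. (cmod (f l))\<^sup>2 * (norm (eigenprojection H l x))\<^sup>2) summable_on UNIV
      then Some (\<Sum>\<^sub>\<infinity>l. f l *\<^sub>C eigenprojection H l x) else None)"

definition exp_op :: "complex \<Rightarrow> ('h::chilbert_space \<rightharpoonup> 'h) \<Rightarrow> 'h \<rightharpoonup> 'h" where
  "exp_op z H = fun_calculus (\<lambda>l. exp (z * complex_of_real l)) H"

text \<open>The time parameter \<open>t\<close> is complex, so that \<open>t = i\<beta>\<close> is allowed.\<close>

definition alpha0 ::
    "('h::chilbert_space \<rightharpoonup> 'h) \<Rightarrow> complex \<Rightarrow> ('h \<Rightarrow> 'h) \<Rightarrow> 'h \<rightharpoonup> 'h" where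
  "alpha0 H t X = exp_op (\<i> * t) H \<circ>\<^sub>m total_op X \<circ>\<^sub>m exp_op (- (\<i> * t)) H"

definition alpha_phi ::
    "('h::chilbert_space \<rightharpoonup> 'h) \<Rightarrow> ('h \<Rightarrow> 'h) \<Rightarrow> complex \<Rightarrow> ('h \<Rightarrow> 'h) \<Rightarrow> 'h \<rightharpoonup> 'h" where
  "alpha_phi H T t X = total_op T \<circ>\<^sub>m alpha0 H t (inv T \<circ> X \<circ> T) \<circ>\<^sub>m total_op (inv T)"

definition Z_phi :: "(nat \<Rightarrow> 'h::chilbert_space) \<Rightarrow> real \<Rightarrow> real" where
  "Z_phi \<phi> \<beta> = (\<Sum>n. exp (- \<beta> * real n) * (norm (\<phi> n))\<^sup>2)"

definition omega_term ::
    "(nat \<Rightarrow> 'h::chilbert_space) \<Rightarrow> real \<Rightarrow> ('h \<rightharpoonup> 'h) \<Rightarrow> nat \<Rightarrow> complex" where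
  "omega_term \<phi> \<beta> X n =
     complex_of_real (exp (- \<beta> * real n)) * cinner (\<phi> n) (the (X (\<phi> n)))"

definition omega_defined ::
    "(nat \<Rightarrow> 'h::chilbert_space) \<Rightarrow> real \<Rightarrow> ('h \<rightharpoonup> 'h) \<Rightarrow> bool" where
  "omega_defined \<phi> \<beta> X \<longleftrightarrow>
     range \<phi> \<subseteq> dom X \<and> summable (\<lambda>n. norm (omega_term \<phi> \<beta> X n))"

definition omega ::
    "(nat \<Rightarrow> 'h::chilbert_space) \<Rightarrow> real \<Rightarrow> ('h \<rightharpoonup> 'h) \<Rightarrow> complex" where
  "omega \<phi> \<beta> X = 1 / complex_of_real (Z_phi \<phi> \<beta>) * (\<Sum>n. omega_term \<phi> \<beta> X n)"

text \<open>The operator \<open>B\<^sub>T = (TT\<^sup>*)\<^sup>-\<^sup>1 B (TT\<^sup>*)\<close>.\<close>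

definition twist :: "('h::chilbert_space \<Rightarrow> 'h) \<Rightarrow> ('h \<Rightarrow> 'h) \<Rightarrow> 'h \<Rightarrow> 'h" where
  "twist T B = inv (T \<circ> cadjoint T) \<circ> B \<circ> (T \<circ> cadjoint T)"

end

theory Submission
  imports Defs
begin

text \<open>
  With \<open>C = T\<^sup>* A T\<close> and \<open>D = T\<^sup>-\<^sup>1 B T\<close> the factor \<open>exp (\<beta> n)\<close> produced by the right-hand
  exponential cancels the weight, so the left-hand functional is the series of
  \<open>\<langle>e\<^sub>n, C exp(-\<beta> H\<^sub>0) D e\<^sub>n\<rangle>\<close>, and the right-hand one is the series of
  \<open>exp (-\<beta> n) \<langle>e\<^sub>n, D C e\<^sub>n\<rangle>\<close>, because \<open>T\<^sup>* (T T\<^sup>*)\<^sup>-\<^sup>1 = T\<^sup>-\<^sup>1\<close>. Expanding \<open>exp(-\<beta> H\<^sub>0)\<close> in the basis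
  turns the first into a double series, absolutely convergent by Bessel's inequality;
  exchanging the sums and applying Parseval gives the second.
\<close>

section \<open>The inner product\<close>

lemma cinner_add_left: "cinner (x + y) z = cinner x z + cinner y (z::'h::chilbert_space)"
  by (metis cinner_add_right cinner_commute complex_cnj_add)

lemma cinner_scaleC_left: "cinner (a *\<^sub>C x) (y::'h::chilbert_space) = cnj a * cinner x y"
  by (metis cinner_commute cinner_scaleC_right complex_cnj_mult)

lemma cinner_zero_right [simp]: "cinner x (0::'h::chilbert_space) = 0"
  using cinner_add_right[of x 0 0] by simp

lemma cinner_zero_left [simp]: "cinner (0::'h::chilbert_space) x = 0"
  using cinner_add_left[of 0 0 x] by simp

lemma cinner_diff_right: "cinner x (y - z) = cinner x y - cinner x (z::'h::chilbert_space)"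
  using cinner_add_right[of x "y - z" z] by simp

lemma cinner_diff_left: "cinner (x - y) z = cinner x z - cinner y (z::'h::chilbert_space)"
  using cinner_add_left[of "x - y" y z] by simp

lemma cinner_sum_right: "cinner x (\<Sum>i\<in>I. f i) = (\<Sum>i\<in>I. cinner x (f i :: 'h::chilbert_space))"
  by (induction I rule: infinite_finite_induct) (simp_all add: cinner_add_right)

lemma cinner_sum_left: "cinner (\<Sum>i\<in>I. f i) x = (\<Sum>i\<in>I. cinner (f i :: 'h::chilbert_space) x)"
  by (induction I rule: infinite_finite_induct) (simp_all add: cinner_add_left)

lemma cmod_cinner_commute: "cmod (cinner x y) = cmod (cinner y (x::'h::chilbert_space))"
  by (metis cinner_commute complex_mod_cnj)

lemma cnj_mult_self: "cnj z * z = complex_of_real ((cmod z)\<^sup>2)"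
  by (metis complex_norm_square mult.commute)

lemma norm_scaleC: "norm (c *\<^sub>C x :: 'h::chilbert_space) = cmod c * norm x"
proof -
  have "complex_of_real ((norm (c *\<^sub>C x))\<^sup>2) = cinner (c *\<^sub>C x) (c *\<^sub>C x)"
    by (simp add: cinner_self)
  also have "\<dots> = c * cnj c * complex_of_real ((norm x)\<^sup>2)"
    by (simp add: cinner_scaleC_left cinner_scaleC_right cinner_self[of x])
  also have "\<dots> = complex_of_real ((cmod c * norm x)\<^sup>2)"
    by (simp add: complex_norm_square[symmetric] power_mult_distrib)
  finally have "(norm (c *\<^sub>C x))\<^sup>2 = (cmod c * norm x)\<^sup>2"
    by (simp only: of_real_eq_iff)
  then show ?thesis
    by (rule power2_eq_imp_eq) simp_all
qed

lemma cinner_eqI: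
  assumes "\<And>u. cinner x u = cinner y u"
  shows "x = (y::'h::chilbert_space)"
proof -
  have "cinner (x - y) (x - y) = 0"
    using assms by (simp add: cinner_diff_left)
  then show ?thesis
    by (simp add: cinner_self)
qed

lemma Cauchy_Schwarz_cinner: "cmod (cinner x y) \<le> norm x * norm (y::'h::chilbert_space)"
proof (cases "x = 0")
  case False
  define a where "a = cinner x y"
  define r where "r = (norm x)\<^sup>2"
  have r: "r > 0"
    using False by (simp add: r_def)
  have yx: "cinner y x = cnj a"
    unfolding a_def by (rule cinner_commute)
  have xx: "cinner x x = complex_of_real r"
    by (simp add: cinner_self r_def)
  have aa: "a * cnj a = complex_of_real ((cmod a)\<^sup>2)"
    by (rule complex_norm_square[symmetric])
  \<comment> \<open>\<open>?z\<close> is the component of \<open>y\<close> orthogonal to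
    \<open>x\<close>; the inequality is the nonnegativity of its squared norm.\<close>
  let ?z = "y - (a / complex_of_real r) *\<^sub>C x"
  have "complex_of_real ((norm ?z)\<^sup>2) = cinner ?z ?z"
    by (simp add: cinner_self)
  also have "\<dots> = complex_of_real ((norm y)\<^sup>2) - a * cnj a / complex_of_real r"
    using r
    by (simp add: cinner_diff_left cinner_diff_right cinner_scaleC_left cinner_scaleC_right
        cinner_self[of y] xx yx a_def[symmetric] field_simps)
  also have "\<dots> = complex_of_real ((norm y)\<^sup>2 - (cmod a)\<^sup>2 / r)"
    by (simp add: aa)
  finally have "(norm ?z)\<^sup>2 = (norm y)\<^sup>2 - (cmod a)\<^sup>2 / r"
    by (simp only: of_real_eq_iff)
  then have "(cmod a)\<^sup>2 / r \<le> (norm y)\<^sup>2"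
    by (smt (verit) zero_le_power2)
  then have "(cmod a)\<^sup>2 \<le> (norm x * norm y)\<^sup>2"
    using r by (simp add: field_simps r_def)
  then show ?thesis
    unfolding a_def by (rule power2_le_imp_le) simp
qed simp

lemma bounded_linear_cinner_right: "bounded_linear (cinner (x::'h::chilbert_space))"
proof (rule bounded_linear_intro)
  show "norm (cinner x y) \<le> norm y * norm x" for y
    using Cauchy_Schwarz_cinner[of x y] by (simp add: mult.commute)
qed (simp_all add: cinner_add_right scaleR_scaleC cinner_scaleC_right scaleR_conv_of_real)

lemma bounded_linear_cinner_left: "bounded_linear (\<lambda>x. cinner x (y::'h::chilbert_space))"
proof (rule bounded_linear_intro)
  show "norm (cinner x y) \<le> norm x * norm y" for x
    by (rule Cauchy_Schwarz_cinner)
qed (simp_all add: cinner_add_left scaleR_scaleC cinner_scaleC_left scaleR_conv_of_real)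

section \<open>Orthonormal bases\<close>

lemma orthonormal_basis_cinner:
  "orthonormal_basis e \<Longrightarrow> cinner (e m) (e n) = (if m = n then 1 else 0)"
  by (simp add: orthonormal_basis_def)

lemma orthonormal_basis_norm: "orthonormal_basis e \<Longrightarrow> norm (e n) = 1"
  using cinner_self[of "e n"] orthonormal_basis_cinner[of e n n]
  by (simp add: power2_eq_1_iff flip: of_real_power)
    (smt (verit) norm_ge_zero of_real_eq_1_iff power2_eq_1_iff)

text \<open>Pythagoras: \<open>?p\<close> is the orthogonal projection of \<open>x\<close> onto the
  first \<open>N\<close> basis vectors, so its inner products with \<open>x\<close> (on either side)
  and with itself all equal \<open>?s\<close>. Nonnegativity of the left side gives Bessel, and
  nonnegativity of the sum makes the remainder map a contraction.\<close>

lemma norm_diff_partial_expansion: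
  fixes e :: "nat \<Rightarrow> 'h::chilbert_space"
  assumes "orthonormal_basis e"
  shows "(norm (x - (\<Sum>n<N. cinner (e n) x *\<^sub>C e n)))\<^sup>2 = (norm x)\<^sup>2 - (\<Sum>n<N. (cmod (cinner (e n) x))\<^sup>2)"
proof -
  let ?p = "\<Sum>n<N. cinner (e n) x *\<^sub>C e n"
  let ?s = "\<Sum>n<N. (cmod (cinner (e n) x))\<^sup>2"
  have coeff: "cinner (e m) ?p = cinner (e m) x" if "m < N" for m
  proof -
    have "cinner (e m) ?p = (\<Sum>n<N. if n = m then cinner (e n) x else 0)"
      unfolding cinner_sum_right
      by (rule sum.cong) (auto simp: cinner_scaleC_right orthonormal_basis_cinner[OF assms])
    then show ?thesis
      using that by simp
  qed
  have px: "cinner ?p x = complex_of_real ?s"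
    by (simp add: cinner_sum_left cinner_scaleC_left cnj_mult_self del: of_real_power)
  have pp: "cinner ?p ?p = complex_of_real ?s"
    by (simp add: cinner_sum_left[of _ _ ?p] cinner_scaleC_left coeff cnj_mult_self del: of_real_power)
  have xp: "cinner x ?p = complex_of_real ?s"
    using px by (metis cinner_commute complex_cnj_complex_of_real)
  have "complex_of_real ((norm (x - ?p))\<^sup>2) = cinner (x - ?p) (x - ?p)"
    by (simp add: cinner_self)
  also have "\<dots> = complex_of_real ((norm x)\<^sup>2 - ?s)"
    by (simp add: cinner_diff_left cinner_diff_right px pp xp cinner_self[of x] del: of_real_sum)
  finally show ?thesis
    by (simp only: of_real_eq_iff)
qed

lemma Bessel:
  fixes e :: "nat \<Rightarrow> 'h::chilbert_space"
  assumes "orthonormal_basis e"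
  shows "(\<Sum>n<N. (cmod (cinner (e n) x))\<^sup>2) \<le> (norm x)\<^sup>2"
  using norm_diff_partial_expansion[OF assms, of x N] by (smt (verit) zero_le_power2)

lemma summable_cinner_squared:
  fixes e :: "nat \<Rightarrow> 'h::chilbert_space"
  assumes "orthonormal_basis e"
  shows "summable (\<lambda>n. (cmod (cinner (e n) x))\<^sup>2)"
    and "(\<Sum>n. (cmod (cinner (e n) x))\<^sup>2) \<le> (norm x)\<^sup>2"
proof -
  show "summable (\<lambda>n. (cmod (cinner (e n) x))\<^sup>2)"
    by (rule summableI_nonneg_bounded[OF _ Bessel[OF assms]]) simp
  then show "(\<Sum>n. (cmod (cinner (e n) x))\<^sup>2) \<le> (norm x)\<^sup>2"
    by (rule suminf_le_const) (rule Bessel[OF assms])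
qed

text \<open>A density argument: for \<open>y\<close> in the span the partial sums
  \<open>P N y\<close> eventually equal \<open>y\<close>, and the remainder maps are contractions
  uniformly in \<open>N\<close>, so convergence passes to the closure of the span.\<close>

lemma orthonormal_basis_expansion:
  fixes e :: "nat \<Rightarrow> 'h::chilbert_space"
  assumes "orthonormal_basis e"
  shows "(\<lambda>n. cinner (e n) x *\<^sub>C e n) sums x"
proof -
  define P where "P N y = (\<Sum>n<N. cinner (e n) y *\<^sub>C e n)" for N y
  have P_add: "P N (y + z) = P N y + P N z" for N y z
    by (simp add: P_def cinner_add_right scaleC_add_left sum.distrib)
  have P_scale: "P N (c *\<^sub>C y) = c *\<^sub>C P N y" for N c y
    by (simp add: P_def cinner_scaleC_right scaleC_scaleC complex_vector.scale_sum_right)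
  have P_diff: "norm (y - P N y) \<le> norm y" for N y
  proof (rule power2_le_imp_le)
    show "(norm (y - P N y))\<^sup>2 \<le> (norm y)\<^sup>2"
      unfolding P_def norm_diff_partial_expansion[OF assms]
      by (simp add: sum_nonneg)
  qed simp
  have span: "eventually (\<lambda>N. P N y = y) sequentially"
    if "y \<in> complex_vector.span (range e)" for y
    using that
  proof (induction rule: complex_vector.span_induct_alt)
    case base
    show ?case by (simp add: P_def)
  next
    case (step c b y)
    then obtain k where k: "b = e k" by auto
    have "P N b = b" if "N > k" for N
    proof -
      have "P N b = (\<Sum>n<N. if n = k then e k else 0)"
        unfolding P_def
        by (rule sum.cong) (auto simp: k orthonormal_basis_cinner[OF assms] scaleC_one)
      then show ?thesis using that k by simp
    qed
    then have "eventually (\<lambda>N. P N b = b) sequentially"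
      using eventually_gt_at_top[of k] by (rule eventually_mono[rotated])
    with step(2) show ?case
      by eventually_elim (simp add: P_add P_scale)
  qed
  have "(\<lambda>N. P N x) \<longlonglongrightarrow> x"
  proof (rule metric_LIMSEQ_I)
    fix r :: real assume "r > 0"
    have "x \<in> closure (complex_vector.span (range e))"
      using assms by (simp add: orthonormal_basis_def)
    then obtain y where y: "y \<in> complex_vector.span (range e)" "dist y x < r"
      using \<open>r > 0\<close> closure_approachable by blast
    obtain N0 where N0: "\<And>N. N \<ge> N0 \<Longrightarrow> P N y = y"
      using span[OF y(1)] by (auto simp: eventually_sequentially)
    have "dist (P N x) x < r" if "N \<ge> N0" for N
    proof -
      \<comment> \<open>\<open>P N\<close> fixes \<open>y\<close>, so the error at \<open>x\<close>
        is the error at the small vector \<open>x - y\<close>.\<close>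
      have "x - P N x = (x - y) - P N (x - y)"
        using P_add[of N "x - y" y] N0[OF that] by simp
      then have "norm (x - P N x) \<le> norm (x - y)"
        by (simp only: P_diff)
      then show ?thesis
        using y(2) by (simp add: dist_norm norm_minus_commute)
    qed
    then show "\<exists>N0. \<forall>N\<ge>N0. dist (P N x) x < r" by blast
  qed
  then show ?thesis
    by (simp add: sums_def P_def)
qed

lemma Parseval:
  fixes e :: "nat \<Rightarrow> 'h::chilbert_space"
  assumes "orthonormal_basis e"
  shows "(\<lambda>n. cinner x (e n) * cinner (e n) y) sums cinner x y"
  using bounded_linear.sums[OF bounded_linear_cinner_right orthonormal_basis_expansion[OF assms], of x y]
  by (simp add: cinner_scaleC_right mult.commute)

lemma orthonormal_basis_eqI:
  fixes e :: "nat \<Rightarrow> 'h::chilbert_space"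
  assumes "orthonormal_basis e" and "\<And>n. cinner (e n) x = cinner (e n) y"
  shows "x = y"
  using orthonormal_basis_expansion[OF assms(1), of x] orthonormal_basis_expansion[OF assms(1), of y]
    assms(2) sums_unique2 by force

section \<open>Adjoints\<close>

lemma bounded_clinear_bounded_linear: "bounded_clinear f \<Longrightarrow> bounded_linear f"
  and bounded_clinear_scaleC: "bounded_clinear f \<Longrightarrow> f (c *\<^sub>C x) = c *\<^sub>C f x"
  by (simp_all add: bounded_clinear_def)

lemma bounded_clinear_comp: "bounded_clinear f \<Longrightarrow> bounded_clinear g \<Longrightarrow> bounded_clinear (f \<circ> g)"
  by (auto simp: bounded_clinear_def o_def intro: bounded_linear_compose)

text \<open>The coordinates of the representing vector are forced to be
  \<open>cnj (f (e n))\<close>; the work lies in convergence. Testing \<open>f\<close> on the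
  partial sums themselves gives \<open>f (v N) = (norm (v N))\<^sup>2\<close>, and cancelling one
  factor \<open>norm (v N)\<close> against the bound for \<open>f\<close> leaves
  \<open>norm (v N) \<le> K\<close>.\<close>

lemma Riesz:
  fixes e :: "nat \<Rightarrow> 'h::chilbert_space" and f :: "'h \<Rightarrow> complex"
  assumes e: "orthonormal_basis e" and f: "bounded_linear f" and fc: "\<And>c x. f (c *\<^sub>C x) = c * f x"
  obtains z where "\<And>u. cinner z u = f u"
proof -
  interpret f: bounded_linear f by fact
  obtain K where K: "K > 0" "\<And>x. norm (f x) \<le> norm x * K"
    using f.pos_bounded by blast
  define a where "a n = cnj (f (e n))" for n
  define v where "v N = (\<Sum>n<N. a n *\<^sub>C e n)" for N
  define s where "s M N = (\<Sum>n=M..<N. (cmod (a n))\<^sup>2)" for M N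
  have norm_block: "(norm (\<Sum>n=M..<N. a n *\<^sub>C e n))\<^sup>2 = s M N" for M N
  proof -
    let ?w = "\<Sum>n=M..<N. a n *\<^sub>C e n"
    have coeff: "cinner (e m) ?w = a m" if "m \<in> {M..<N}" for m
    proof -
      have "cinner (e m) ?w = (\<Sum>n=M..<N. if n = m then a n else 0)"
        unfolding cinner_sum_right
        by (rule sum.cong) (auto simp: cinner_scaleC_right orthonormal_basis_cinner[OF e])
      then show ?thesis using that by simp
    qed
    have "cinner ?w ?w = (\<Sum>n=M..<N. cnj (a n) * cinner (e n) ?w)"
      by (simp add: cinner_sum_left[of _ _ ?w] cinner_scaleC_left)
    also have "\<dots> = (\<Sum>n=M..<N. complex_of_real ((cmod (a n))\<^sup>2))"
      by (intro sum.cong refl) (simp add: coeff cnj_mult_self del: of_real_power)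
    finally have "complex_of_real ((norm ?w)\<^sup>2) = complex_of_real (s M N)"
      by (simp add: cinner_self s_def)
    then show ?thesis by (simp only: of_real_eq_iff)
  qed
  have v0: "(norm (v N))\<^sup>2 = s 0 N" for N
    using norm_block[of 0 N] by (simp add: v_def lessThan_atLeast0)
  have s_bound: "s 0 N \<le> K\<^sup>2" for N
  proof -
    have "f (v N) = (\<Sum>n<N. complex_of_real ((cmod (a n))\<^sup>2))"
      by (simp add: v_def f.sum fc a_def cnj_mult_self del: of_real_power)
    also have "\<dots> = complex_of_real (s 0 N)"
      by (simp add: s_def lessThan_atLeast0)
    finally have "s 0 N \<le> norm (v N) * K"
      using K(2)[of "v N"] by simp
    then have "norm (v N) * norm (v N) \<le> norm (v N) * K"
      using v0[of N] by (simp add: power2_eq_square)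
    then have "norm (v N) \<le> K"
      using K(1) by (cases "v N = 0") auto
    then show ?thesis
      using v0[of N] power_mono[of "norm (v N)" K 2] by simp
  qed
  have "summable (\<lambda>n. (cmod (a n))\<^sup>2)"
    using s_bound by (intro summableI_nonneg_bounded[where x = "K\<^sup>2"]) (auto simp: s_def lessThan_atLeast0)
  then have small: "\<exists>N. \<forall>m\<ge>N. \<forall>n. norm (\<Sum>n=m..<n. (cmod (a n))\<^sup>2) < r" if "r > 0" for r
    using that by (simp add: summable_Cauchy)
  have "summable (\<lambda>n. a n *\<^sub>C e n)"
    unfolding summable_Cauchy
  proof (intro allI impI)
    fix r :: real assume "r > 0"
    \<comment> \<open>By \<open>norm_block\<close> the squared norm of a block of the vector series
      is a block of a summable real series, hence the tolerance \<open>r\<^sup>2\<close>.\<close>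
    then obtain N where N: "\<forall>m\<ge>N. \<forall>n. norm (s m n) < r\<^sup>2"
      using small[of "r\<^sup>2"] by (auto simp: s_def)
    have "norm (\<Sum>n=m..<n. a n *\<^sub>C e n) < r" if "m \<ge> N" for m n
    proof (rule power2_less_imp_less)
      show "(norm (\<Sum>n=m..<n. a n *\<^sub>C e n))\<^sup>2 < r\<^sup>2"
        using N that unfolding norm_block by (metis abs_le_D1 le_less_trans order_refl real_norm_def)
    qed (use \<open>r > 0\<close> in simp)
    then show "\<exists>N. \<forall>m\<ge>N. \<forall>n. norm (\<Sum>n=m..<n. a n *\<^sub>C e n) < r" by blast
  qed
  then obtain z where z: "(\<lambda>n. a n *\<^sub>C e n) sums z"
    by (auto simp: summable_def)
  have "cinner z u = f u" for u
  proof -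
    have "(\<lambda>n. cinner (a n *\<^sub>C e n) u) sums cinner z u"
      by (rule bounded_linear.sums[OF bounded_linear_cinner_left z])
    moreover have "(\<lambda>n. f (cinner (e n) u *\<^sub>C e n)) sums f u"
      by (rule f.sums[OF orthonormal_basis_expansion[OF e]])
    ultimately show ?thesis
      by (simp add: cinner_scaleC_left a_def fc mult.commute sums_unique2)
  qed
  then show thesis by (rule that)
qed

text \<open>Justifies the description operator in \<open>cadjoint\<close>: Riesz supplies existence,
  nondegeneracy of the inner product supplies uniqueness. Later arguments use the adjoint only
  through this identity.\<close>

lemma cinner_cadjoint:
  fixes e :: "nat \<Rightarrow> 'h::chilbert_space" and f :: "'h \<Rightarrow> 'h"
  assumes e: "orthonormal_basis e" and f: "bounded_clinear f"
  shows "cinner (cadjoint f x) u = cinner x (f u)"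
proof -
  have "bounded_linear (\<lambda>u. cinner x (f u))"
    using bounded_linear_compose[OF bounded_linear_cinner_right bounded_clinear_bounded_linear[OF f]] .
  then obtain z where z: "\<And>u. cinner z u = cinner x (f u)"
    using Riesz[OF e, of "\<lambda>u. cinner x (f u)"]
    by (auto simp: bounded_clinear_scaleC[OF f] cinner_scaleC_right)
  have "cadjoint f x = z"
    unfolding cadjoint_def by (rule the_equality) (auto simp: z intro: cinner_eqI)
  then show ?thesis by (simp add: z)
qed

lemma cinner_cadjoint_right:
  fixes e :: "nat \<Rightarrow> 'h::chilbert_space" and f :: "'h \<Rightarrow> 'h"
  assumes e: "orthonormal_basis e" and f: "bounded_clinear f"
  shows "cinner u (cadjoint f x) = cinner (f u) x"
  by (metis cinner_cadjoint[OF assms] cinner_commute)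

lemma bounded_clinear_cadjoint:
  fixes e :: "nat \<Rightarrow> 'h::chilbert_space" and f :: "'h \<Rightarrow> 'h"
  assumes e: "orthonormal_basis e" and f: "bounded_clinear f"
  shows "bounded_clinear (cadjoint f)"
proof -
  note adj = cinner_cadjoint[OF assms]
  obtain K where K: "K > 0" "\<And>x. norm (f x) \<le> norm x * K"
    using bounded_linear.pos_bounded[OF bounded_clinear_bounded_linear[OF f]] by blast
  have scale: "cadjoint f (c *\<^sub>C x) = c *\<^sub>C cadjoint f x" for c x
    by (rule cinner_eqI) (simp add: adj cinner_scaleC_left)
  have "bounded_linear (cadjoint f)"
  proof (rule bounded_linear_intro)
    show "cadjoint f (x + y) = cadjoint f x + cadjoint f y" for x y
      by (rule cinner_eqI) (simp add: adj cinner_add_left)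
    show "cadjoint f (r *\<^sub>R x) = r *\<^sub>R cadjoint f x" for r x
      by (simp add: scaleR_scaleC scale)
    show "norm (cadjoint f x) \<le> norm x * K" for x
    proof -
      let ?y = "cadjoint f x"
      \<comment> \<open>Testing the adjoint identity on \<open>?y\<close> itself produces its
        squared norm; Cauchy-Schwarz and cancelling one factor then give the same bound
        \<open>K\<close> as for \<open>f\<close>.\<close>
      have "cinner x (f ?y) = complex_of_real ((norm ?y)\<^sup>2)"
        using adj[of x ?y] by (simp add: cinner_self)
      then have "cmod (cinner x (f ?y)) = (norm ?y)\<^sup>2"
        by (simp only: norm_of_real abs_power2)
      then have "(norm ?y)\<^sup>2 \<le> norm x * norm (f ?y)"
        using Cauchy_Schwarz_cinner[of x "f ?y"] by simp
      also have "\<dots> \<le> norm x * (norm ?y * K)"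
        by (intro mult_left_mono K) simp
      finally have "norm ?y * norm ?y \<le> norm ?y * (norm x * K)"
        by (simp add: power2_eq_square mult_ac)
      then show ?thesis
        using K(1) by (cases "?y = 0") auto
    qed
  qed
  then show ?thesis
    by (simp add: bounded_clinear_def scale)
qed

text \<open>The inverse is the adjoint of \<open>inv T\<close>, since taking adjoints reverses
  products.\<close>

lemma bij_cadjoint:
  fixes e :: "nat \<Rightarrow> 'h::chilbert_space" and T :: "'h \<Rightarrow> 'h"
  assumes e: "orthonormal_basis e" and T: "bounded_clinear T" "bij T" "bounded_clinear (inv T)"
  shows "bij (cadjoint T)"
proof (rule o_bij)
  note adj = cinner_cadjoint[OF e T(1)] cinner_cadjoint[OF e T(3)]
  show "cadjoint (inv T) \<circ> cadjoint T = id"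
    by (rule ext, rule cinner_eqI)
      (simp add: adj surj_f_inv_f[OF bij_is_surj[OF T(2)]])
  show "cadjoint T \<circ> cadjoint (inv T) = id"
    by (rule ext, rule cinner_eqI)
      (simp add: adj inv_f_f[OF bij_is_inj[OF T(2)]])
qed

section \<open>Functional calculus of the number operator\<close>

text \<open>Orthogonality of eigenvectors for different eigenvalues. Self-adjointness enters by
  reading \<open>H x\<close> as a value of \<open>adj_op H\<close>: then \<open>l\<close> times
  \<open>x\<close> satisfies the defining identity of the adjoint, which is evaluated at
  \<open>e n\<close>.\<close>

lemma self_adjoint_eigenvector:
  fixes e :: "nat \<Rightarrow> 'h::chilbert_space"
  assumes e: "orthonormal_basis e" and H: "self_adjoint H"
    and He: "\<And>n. H (e n) = Some (complex_of_real (real n) *\<^sub>C e n)"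
    and x: "H x = Some (complex_of_real l *\<^sub>C x)" and "real n \<noteq> l"
  shows "cinner (e n) x = 0"
proof -
  define P where "P z \<longleftrightarrow> (\<forall>u\<in>dom H. cinner z u = cinner x (the (H u)))" for z
  have dom: "e n \<in> dom H" for n
    using He[of n] by (rule domI)
  have "adj_op H x = H x"
    using H by (simp add: self_adjoint_def)
  then have *: "(\<exists>z. P z) \<and> (THE z. P z) = complex_of_real l *\<^sub>C x"
    using x unfolding adj_op_def P_def by (metis (no_types, lifting) option.distinct(1) option.inject)
  \<comment> \<open>The description in \<open>adj_op\<close> is only known to satisfy
    \<open>P\<close> once uniqueness is established; here it follows because the domain contains
    every \<open>e n\<close>.\<close>
  have uniq: "z = z'" if "P z" "P z'" for z z'
  proof (rule orthonormal_basis_eqI[OF e])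
    fix k
    have "cinner z (e k) = cinner z' (e k)"
      using that dom[of k] by (simp add: P_def)
    then show "cinner (e k) z = cinner (e k) z'"
      by (metis cinner_commute)
  qed
  have "P (complex_of_real l *\<^sub>C x)"
    using * uniq by (metis the_equality)
  then have "complex_of_real l * cinner x (e n) = complex_of_real (real n) * cinner x (e n)"
    using dom[of n] by (simp add: P_def He cinner_scaleC_left cinner_scaleC_right)
  then have "cinner x (e n) = 0"
    using \<open>real n \<noteq> l\<close> by (metis mult_right_cancel of_real_eq_iff)
  then show ?thesis
    by (metis cinner_commute complex_cnj_zero)
qed

text \<open>The eigenspace at \<open>n\<close> is exactly the line through \<open>e n\<close>, and
  every other eigenspace is trivial, because an eigenvector is orthogonal to all basis vectors with
  a different eigenvalue.\<close>

lemma eigenprojection_number_operator: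
  fixes e :: "nat \<Rightarrow> 'h::chilbert_space"
  assumes e: "orthonormal_basis e" and H: "self_adjoint H"
    and He: "\<And>n. H (e n) = Some (complex_of_real (real n) *\<^sub>C e n)"
  shows "eigenprojection H (real n) x = cinner (e n) x *\<^sub>C e n"
    and "l \<notin> range real \<Longrightarrow> eigenprojection H l x = 0"
proof -
  have lin: "linear_op H" using H by (simp add: self_adjoint_def)
  have orth: "cinner (e n) y = 0" if "y \<in> eigenspace H l" "real n \<noteq> l" for n y l
    using self_adjoint_eigenvector[OF e H He _ that(2)] that(1) by (simp add: eigenspace_def)
  have dom: "e n \<in> dom H" for n
    using He[of n] by (rule domI)
  have mem: "c *\<^sub>C e n \<in> eigenspace H (real n)" for c n
  proof -
    have "c *\<^sub>C e n \<in> dom H"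
      using lin dom[of n] by (simp add: linear_op_def complex_vector.subspace_scale)
    moreover have "the (H (c *\<^sub>C e n)) = complex_of_real (real n) *\<^sub>C c *\<^sub>C e n"
      using lin dom[of n] by (simp add: linear_op_def He scaleC_scaleC mult.commute)
    ultimately show ?thesis
      by (auto simp: eigenspace_def)
  qed
  have form: "y = cinner (e n) y *\<^sub>C e n" if "y \<in> eigenspace H (real n)" for y n
  proof (rule orthonormal_basis_eqI[OF e])
    fix m
    show "cinner (e m) y = cinner (e m) (cinner (e n) y *\<^sub>C e n)"
      using orth[OF that, of m] by (cases "m = n") (simp_all add: cinner_scaleC_right orthonormal_basis_cinner[OF e])
  qed
  show "eigenprojection H (real n) x = cinner (e n) x *\<^sub>C e n"
    unfolding eigenprojection_def
  proof (rule the_equality)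
    show "cinner (e n) x *\<^sub>C e n \<in> eigenspace H (real n) \<and>
      (\<forall>z\<in>eigenspace H (real n). cinner z (x - cinner (e n) x *\<^sub>C e n) = 0)"
    proof (intro conjI ballI mem)
      fix z assume "z \<in> eigenspace H (real n)"
      then obtain c where "z = c *\<^sub>C e n" using form by blast
      then show "cinner z (x - cinner (e n) x *\<^sub>C e n) = 0"
        by (simp add: cinner_scaleC_left cinner_diff_right cinner_scaleC_right orthonormal_basis_cinner[OF e])
    qed
  next
    fix y assume y: "y \<in> eigenspace H (real n) \<and> (\<forall>z\<in>eigenspace H (real n). cinner z (x - y) = 0)"
    have "e n \<in> eigenspace H (real n)"
      using mem[of 1 n] by (simp add: scaleC_one)
    then have "cinner (e n) x = cinner (e n) y"
      using y by (simp add: cinner_diff_right)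
    then show "y = cinner (e n) x *\<^sub>C e n"
      using form y by metis
  qed
  show "eigenprojection H l x = 0" if l: "l \<notin> range real"
  proof -
    \<comment> \<open>The zero multiple of \<open>e 0\<close> shows \<open>H 0 = Some 0\<close>,
      which puts \<open>0\<close> in every eigenspace.\<close>
    have "0 \<in> eigenspace H l"
      using mem[of 0 0] by (simp add: eigenspace_def)
    moreover have "y = 0" if "y \<in> eigenspace H l" for y
    proof (rule orthonormal_basis_eqI[OF e])
      show "cinner (e n) y = cinner (e n) 0" for n
        using orth[OF that, of n] l by auto
    qed
    ultimately have "eigenspace H l = {0}" by auto
    then show ?thesis
      unfolding eigenprojection_def by (auto intro!: the_equality)
  qed
qed

text \<open>Both sums over all real \<open>l\<close> live on \<open>range real\<close>, where the
  projections do not vanish identically, and are reindexed along the injection \<open>real\<close>.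
  The hypothesis \<open>sq\<close> is the domain condition in coordinates; convergence of the
  resulting vector sum is settled where it is needed.\<close>

lemma fun_calculus_number_operator:
  fixes e :: "nat \<Rightarrow> 'h::chilbert_space"
  assumes e: "orthonormal_basis e" and H: "self_adjoint H"
    and He: "\<And>n. H (e n) = Some (complex_of_real (real n) *\<^sub>C e n)"
    and sq: "summable (\<lambda>n. (cmod (f (real n)))\<^sup>2 * (cmod (cinner (e n) x))\<^sup>2)"
  shows "fun_calculus f H x = Some (\<Sum>\<^sub>\<infinity>n. (f (real n) * cinner (e n) x) *\<^sub>C e n)"
proof -
  note proj = eigenprojection_number_operator[OF e H He]
  have "(\<lambda>n. (cmod (f (real n)))\<^sup>2 * (cmod (cinner (e n) x))\<^sup>2) summable_on UNIV"
    using sq by (subst summable_on_UNIV_nonneg_real_iff) simp_all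
  then have "((\<lambda>l. (cmod (f l))\<^sup>2 * (norm (eigenprojection H l x))\<^sup>2) \<circ> real) summable_on UNIV"
    by (simp add: o_def proj(1) norm_scaleC orthonormal_basis_norm[OF e])
  then have "(\<lambda>l. (cmod (f l))\<^sup>2 * (norm (eigenprojection H l x))\<^sup>2) summable_on range real"
    by (subst summable_on_reindex) (auto simp: inj_on_def)
  then have "(\<lambda>l. (cmod (f l))\<^sup>2 * (norm (eigenprojection H l x))\<^sup>2) summable_on UNIV"
    by (subst (asm) summable_on_cong_neutral[where T = UNIV]) (auto simp: proj(2))
  moreover have "(\<Sum>\<^sub>\<infinity>l. f l *\<^sub>C eigenprojection H l x) = (\<Sum>\<^sub>\<infinity>l\<in>range real. f l *\<^sub>C eigenprojection H l x)"
    by (rule infsum_cong_neutral) (auto simp: proj(2))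
  moreover have "\<dots> = (\<Sum>\<^sub>\<infinity>n. (f (real n) * cinner (e n) x) *\<^sub>C e n)"
    by (subst infsum_reindex) (auto simp: inj_on_def o_def proj(1) scaleC_scaleC)
  ultimately show ?thesis
    by (simp add: fun_calculus_def)
qed

text \<open>On a basis vector a single term survives, so \<open>z\<close> is arbitrary; this covers
  the growing exponential, which is unbounded.\<close>

lemma exp_op_basis:
  fixes e :: "nat \<Rightarrow> 'h::chilbert_space"
  assumes e: "orthonormal_basis e" and H: "self_adjoint H"
    and He: "\<And>n. H (e n) = Some (complex_of_real (real n) *\<^sub>C e n)"
  shows "exp_op z H (e k) = Some (exp (z * complex_of_real (real k)) *\<^sub>C e k)"
proof -
  let ?f = "\<lambda>l. exp (z * complex_of_real l)"
  have "summable (\<lambda>n. (cmod (?f (real n)))\<^sup>2 * (cmod (cinner (e n) (e k)))\<^sup>2)"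
    by (rule summable_finite[of "{k}"]) (auto simp: orthonormal_basis_cinner[OF e])
  from fun_calculus_number_operator[OF e H He this]
  have "exp_op z H (e k) = Some (\<Sum>\<^sub>\<infinity>n. (?f (real n) * cinner (e n) (e k)) *\<^sub>C e n)"
    by (simp add: exp_op_def)
  also have "(\<Sum>\<^sub>\<infinity>n. (?f (real n) * cinner (e n) (e k)) *\<^sub>C e n)
      = (\<Sum>\<^sub>\<infinity>n\<in>{k}. (?f (real n) * cinner (e n) (e k)) *\<^sub>C e n)"
    by (rule infsum_cong_neutral) (auto simp: orthonormal_basis_cinner[OF e])
  finally show ?thesis
    by (simp add: orthonormal_basis_cinner[OF e])
qed

lemma summable_exp_neg:
  fixes \<beta> :: real
  assumes "\<beta> > 0"
  shows "summable (\<lambda>n. exp (- \<beta> * real n))"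
proof -
  have "exp (- \<beta> * real n) = exp (- \<beta>) ^ n" for n
    by (metis exp_of_nat_mult mult.commute)
  then show ?thesis
    using assms by (simp add: summable_geometric)
qed

text \<open>The decaying exponential is defined everywhere. Its summable weights make the expansion
  absolutely convergent, so the unordered sum of the functional calculus is also an ordinary
  series.\<close>

lemma exp_op_neg:
  fixes e :: "nat \<Rightarrow> 'h::chilbert_space" and \<beta> :: real
  assumes e: "orthonormal_basis e" and H: "self_adjoint H"
    and He: "\<And>n. H (e n) = Some (complex_of_real (real n) *\<^sub>C e n)"
    and \<beta>: "\<beta> > 0"
  obtains y where "exp_op (- complex_of_real \<beta>) H x = Some y"
    and "(\<lambda>n. (complex_of_real (exp (- \<beta> * real n)) * cinner (e n) x) *\<^sub>C e n) sums y"
proof -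
  let ?f = "\<lambda>l. exp (- complex_of_real \<beta> * complex_of_real l)"
  let ?g = "\<lambda>n. (complex_of_real (exp (- \<beta> * real n)) * cinner (e n) x) *\<^sub>C e n"
  have f: "?f (real n) = complex_of_real (exp (- \<beta> * real n))" for n
    by (simp flip: exp_of_real)
  have "summable (\<lambda>n. (cmod (?f (real n)))\<^sup>2 * (cmod (cinner (e n) x))\<^sup>2)"
  proof (rule summable_comparison_test')
    show "summable (\<lambda>n. (cmod (cinner (e n) x))\<^sup>2)"
      by (rule summable_cinner_squared[OF e])
    show "norm ((cmod (?f (real n)))\<^sup>2 * (cmod (cinner (e n) x))\<^sup>2) \<le> (cmod (cinner (e n) x))\<^sup>2" for n
      unfolding f using \<beta> by (simp add: mult_left_le_one_le power_le_one)
  qed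
  from fun_calculus_number_operator[OF e H He this]
  have eq: "exp_op (- complex_of_real \<beta>) H x = Some (\<Sum>\<^sub>\<infinity>n. ?g n)"
    by (simp only: exp_op_def f)
  have "summable (\<lambda>n. norm (?g n))"
  proof (rule summable_comparison_test')
    show "summable (\<lambda>n. exp (- \<beta> * real n) * norm x)"
      by (intro summable_mult2 summable_exp_neg \<beta>)
    show "norm (norm (?g n)) \<le> exp (- \<beta> * real n) * norm x" for n
      using Cauchy_Schwarz_cinner[of "e n" x]
      by (simp add: norm_scaleC norm_mult orthonormal_basis_norm[OF e])
  qed
  then have "?g summable_on UNIV"
    by (rule norm_summable_imp_summable_on)
  then have "?g sums (\<Sum>\<^sub>\<infinity>n. ?g n)"
    by (intro has_sum_imp_sums has_sum_infsum)
  with eq show thesis by (rule that)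
qed

section \<open>The trace identity\<close>

text \<open>Cyclicity of the trace: with \<open>W\<close> the diagonal operator of the weights
  \<open>w\<close>, \<open>y n\<close> is \<open>W D e n\<close>, and the traces of
  \<open>C W D\<close> and \<open>W D C\<close> agree. Both are iterated sums of one double series
  \<open>F\<close>.\<close>

lemma trace_swap:
  fixes e :: "nat \<Rightarrow> 'h::chilbert_space" and w :: "nat \<Rightarrow> real"
  assumes e: "orthonormal_basis e" and C: "bounded_clinear C" and D: "bounded_clinear D"
    and w0: "\<And>m. w m \<ge> 0" and w: "summable w"
    and y: "\<And>n. (\<lambda>m. (complex_of_real (w m) * cinner (e m) (D (e n))) *\<^sub>C e m) sums y n"
  shows "summable (\<lambda>n. norm (cinner (e n) (C (y n))))"
    and "(\<Sum>n. cinner (e n) (C (y n))) = (\<Sum>m. complex_of_real (w m) * cinner (e m) (D (C (e m))))"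
proof -
  \<comment> \<open>Moving \<open>D\<close> to the left makes row \<open>m\<close> of
    \<open>F\<close> a product of coordinates of the two vectors \<open>E (e m)\<close> and
    \<open>C (e m)\<close>, to which Bessel and Parseval apply.\<close>
  define E where "E = cadjoint D"
  have E: "cinner (e m) (D u) = cinner (E (e m)) u" for m u
    by (simp add: E_def cinner_cadjoint[OF e D])
  define F where "F m n = complex_of_real (w m) * (cinner (E (e m)) (e n) * cinner (e n) (C (e m)))" for m n
  obtain K where K: "\<And>x. norm (E x) \<le> norm x * K"
    using bounded_linear.bounded[OF bounded_clinear_bounded_linear[OF bounded_clinear_cadjoint[OF e D]]]
    unfolding E_def by blast
  obtain L where L: "\<And>x. norm (C x) \<le> norm x * L"
    using bounded_linear.bounded[OF bounded_clinear_bounded_linear[OF C]] by blast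
  \<comment> \<open>A majorant of the coordinate product, by
    \<open>s * t \<le> s\<^sup>2 + t\<^sup>2\<close>. Its row sums are bounded uniformly in
    \<open>m\<close>, so summability of \<open>w\<close> controls the whole double series.\<close>
  define b where "b m n = (cmod (cinner (e n) (E (e m))))\<^sup>2 + (cmod (cinner (e n) (C (e m))))\<^sup>2" for m n
  have b_sum: "summable (b m)" for m
    unfolding b_def by (intro summable_add summable_cinner_squared[OF e])
  have b_le: "(\<Sum>n. b m n) \<le> K\<^sup>2 + L\<^sup>2" for m
  proof -
    have "(\<Sum>n. b m n) \<le> (norm (E (e m)))\<^sup>2 + (norm (C (e m)))\<^sup>2"
      unfolding b_def
      by (subst suminf_add[symmetric]) (intro add_mono summable_cinner_squared[OF e])+
    also have "\<dots> \<le> K\<^sup>2 + L\<^sup>2"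
      using K[of "e m"] L[of "e m"]
      by (intro add_mono power_mono) (simp_all add: orthonormal_basis_norm[OF e])
    finally show ?thesis .
  qed
  have F_le: "norm (F m n) \<le> w m * b m n" for m n
  proof -
    have ab: "s * t \<le> s\<^sup>2 + t\<^sup>2" if "s \<ge> 0" "t \<ge> 0" for s t :: real
      using sum_squares_bound[of s t] that mult_nonneg_nonneg[OF that] by linarith
    have "cmod (cinner (E (e m)) (e n)) * cmod (cinner (e n) (C (e m))) \<le> b m n"
      unfolding b_def cmod_cinner_commute[of "E (e m)"] by (rule ab) simp_all
    then show ?thesis
      unfolding F_def norm_mult using w0[of m] by (simp add: mult_left_mono)
  qed
  have F_sum: "summable (\<lambda>n. norm (F m n))" for m
    by (rule summable_comparison_test'[OF summable_mult[OF b_sum[of m], of "w m"]]) (simp add: F_le)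
  have F_inf: "(\<Sum>n. norm (F m n)) \<le> w m * (K\<^sup>2 + L\<^sup>2)" for m
  proof -
    have "(\<Sum>n. norm (F m n)) \<le> (\<Sum>n. w m * b m n)"
      by (rule suminf_le[OF F_le F_sum summable_mult[OF b_sum]])
    also have "\<dots> = w m * (\<Sum>n. b m n)"
      by (rule suminf_mult[OF b_sum])
    also have "\<dots> \<le> w m * (K\<^sup>2 + L\<^sup>2)"
      by (intro mult_left_mono b_le w0)
    finally show ?thesis .
  qed
  \<comment> \<open>The exchange of sums is carried out with unordered sums, while the functional is
    an ordered series; \<open>inf_eq\<close> and \<open>real_on\<close> translate between
    them.\<close>
  have inf_eq: "(\<Sum>\<^sub>\<infinity>n. f n) = (\<Sum>n. f n)" if "summable (\<lambda>n. norm (f n))" for f :: "nat \<Rightarrow> 'b::banach"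
    using norm_summable_imp_summable_on[OF that]
    by (metis has_sum_imp_sums has_sum_infsum sums_unique)
  have real_on: "f summable_on UNIV \<longleftrightarrow> summable f" if "\<And>n. f n \<ge> 0" for f :: "nat \<Rightarrow> real"
    using that by (simp add: summable_on_UNIV_nonneg_real_iff)
  have outer: "summable (\<lambda>m. \<Sum>n. norm (F m n))"
    by (rule summable_comparison_test'[OF summable_mult2[OF w, of "K\<^sup>2 + L\<^sup>2"]])
      (simp add: F_inf suminf_nonneg[OF F_sum])
  have abs: "(\<lambda>p. norm (case p of (m, n) \<Rightarrow> F m n)) summable_on (UNIV \<times> UNIV)"
  proof (subst Infinite_Sum.abs_summable_on_Sigma_iff, intro conjI ballI)
    show "(\<lambda>n. norm (case (m, n) of (m, n) \<Rightarrow> F m n)) summable_on UNIV" for m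
      using F_sum[of m] by (simp add: real_on)
    have "(\<Sum>\<^sub>\<infinity>n. norm (F m n)) = (\<Sum>n. norm (F m n))" for m
      using F_sum[of m] by (intro inf_eq) simp
    then show "(\<lambda>m. norm (\<Sum>\<^sub>\<infinity>n. norm (case (m, n) of (m, n) \<Rightarrow> F m n))) summable_on UNIV"
      using outer by (simp add: real_on suminf_nonneg[OF F_sum])
  qed
  then have abs': "(\<lambda>p. norm (case p of (n, m) \<Rightarrow> F m n)) summable_on (UNIV \<times> UNIV)"
    using summable_on_swap[of "\<lambda>p. norm (case p of (m, n) \<Rightarrow> F m n)" UNIV UNIV]
    by (simp add: case_prod_beta' o_def)
  \<comment> \<open>The criterion used for \<open>abs\<close> is read backwards on the transposed
    family: it yields summable columns and summable column totals.\<close>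
  have col: "\<And>n. summable (\<lambda>m. norm (F m n))"
    and outer': "summable (\<lambda>n. \<Sum>\<^sub>\<infinity>m. norm (F m n))"
    using abs' unfolding Infinite_Sum.abs_summable_on_Sigma_iff
    by (simp_all add: real_on infsum_nonneg)
  have row_sum: "(\<Sum>n. F m n) = complex_of_real (w m) * cinner (e m) (D (C (e m)))" for m
    unfolding F_def E using sums_mult[OF Parseval[OF e, of "E (e m)" "C (e m)"]] by (metis sums_unique)
  have col_sum: "(\<Sum>m. F m n) = cinner (e n) (C (y n))" for n
  proof -
    have "(\<lambda>m. cinner (e n) (C ((complex_of_real (w m) * cinner (e m) (D (e n))) *\<^sub>C e m))) sums cinner (e n) (C (y n))"
      by (intro bounded_linear.sums[OF bounded_linear_cinner_right]
          bounded_linear.sums[OF bounded_clinear_bounded_linear[OF C]] y)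
    then show ?thesis
      by (simp add: F_def bounded_clinear_scaleC[OF C] cinner_scaleC_right E mult.assoc sums_iff)
  qed
  \<comment> \<open>The column totals dominate the terms of the left-hand trace, which gives its
    absolute convergence.\<close>
  have le: "norm (cinner (e n) (C (y n))) \<le> (\<Sum>\<^sub>\<infinity>m. norm (F m n))" for n
    using summable_norm[OF col[of n]] inf_eq[of "\<lambda>m. norm (F m n)"] col[of n] by (simp add: col_sum)
  show sm: "summable (\<lambda>n. norm (cinner (e n) (C (y n))))"
    by (rule summable_comparison_test'[OF outer']) (simp add: le)
  have "(\<Sum>n. cinner (e n) (C (y n))) = (\<Sum>\<^sub>\<infinity>n. \<Sum>\<^sub>\<infinity>m. F m n)"
    using inf_eq[OF sm] inf_eq[OF col] by (simp add: col_sum)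
  also have "\<dots> = (\<Sum>\<^sub>\<infinity>m. \<Sum>\<^sub>\<infinity>n. F m n)"
    using abs_summable_summable[OF abs'] by (rule infsum_swap_banach)
  also have "\<dots> = (\<Sum>\<^sub>\<infinity>m. \<Sum>n. F m n)"
    using inf_eq[OF F_sum] by simp
  also have "\<dots> = (\<Sum>m. \<Sum>n. F m n)"
  proof (rule inf_eq, rule summable_comparison_test'[OF outer])
    show "norm (norm (\<Sum>n. F m n)) \<le> (\<Sum>n. norm (F m n))" for m
      using summable_norm[OF F_sum[of m]] by simp
  qed
  finally show "(\<Sum>n. cinner (e n) (C (y n))) = (\<Sum>m. complex_of_real (w m) * cinner (e m) (D (C (e m))))"
    by (simp add: row_sum)
qed

section \<open>Reduction of the two functionals to the trace identity\<close>

theorem mainTheorem4: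
  fixes e \<phi> :: "nat \<Rightarrow> 'h::chilbert_space"
    and H0 :: "'h \<rightharpoonup> 'h"
    and T :: "'h \<Rightarrow> 'h"
    and \<beta> :: real
  assumes "orthonormal_basis e"
    and "self_adjoint H0" and "\<And>n. H0 (e n) = Some (complex_of_real (real n) *\<^sub>C e n)"
    and "bounded_clinear T" and "bij T" and "bounded_clinear (inv T)"
    and "\<And>n. \<phi> n = T (e n)"
    and "\<beta> > 0"
  shows "summable (\<lambda>n. exp (- \<beta> * real n) * (norm (\<phi> n))\<^sup>2) \<and> Z_phi \<phi> \<beta> > 0 \<and>
    (\<forall>A B. bounded_clinear A \<longrightarrow> bounded_clinear B \<longrightarrow>
       omega_defined \<phi> \<beta> (total_op A \<circ>\<^sub>m alpha_phi H0 T (\<i> * complex_of_real \<beta>) B) \<and>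
       omega_defined \<phi> \<beta> (total_op (twist T B \<circ> A)) \<and>
       omega \<phi> \<beta> (total_op A \<circ>\<^sub>m alpha_phi H0 T (\<i> * complex_of_real \<beta>) B)
         = omega \<phi> \<beta> (total_op (twist T B \<circ> A)) \<and>
       (B \<circ> (T \<circ> cadjoint T) = (T \<circ> cadjoint T) \<circ> B \<longrightarrow>
         omega_defined \<phi> \<beta> (total_op (B \<circ> A)) \<and>
         omega \<phi> \<beta> (total_op (B \<circ> A))
           = omega \<phi> \<beta> (total_op A \<circ>\<^sub>m alpha_phi H0 T (\<i> * complex_of_real \<beta>) B)))"
proof -
  note e = assms(1) and H = assms(2,3) and T = assms(4-6) and \<phi> = assms(7) and \<beta> = assms(8)
  define w where "w n = exp (- \<beta> * real n)" for n
  have w: "summable w"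
    unfolding w_def by (rule summable_exp_neg[OF \<beta>])
  note Tlin = bounded_clinear_bounded_linear[OF T(1)]
  have inv_T [simp]: "inv T (T x) = x" "T (inv T x) = x" for x
    using T(2) by (simp_all add: bij_is_inj bij_is_surj inv_f_f surj_f_inv_f)
  obtain K where K: "\<And>x. norm (T x) \<le> norm x * K"
    using bounded_linear.bounded[OF Tlin] by blast
  have sumZ: "summable (\<lambda>n. w n * (norm (\<phi> n))\<^sup>2)"
  proof (rule summable_comparison_test'[OF summable_mult2[OF w, of "K\<^sup>2"]])
    show "norm (w n * (norm (\<phi> n))\<^sup>2) \<le> w n * K\<^sup>2" for n
      using power_mono[OF K[of "e n"], of 2]
      by (simp add: w_def \<phi> orthonormal_basis_norm[OF e])
  qed
  \<comment> \<open>Injectivity of \<open>T\<close> makes every term of the series for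
    \<open>Z_phi\<close> strictly positive.\<close>
  have "\<phi> n \<noteq> 0" for n
    using inv_T(1)[of "e n"] orthonormal_basis_norm[OF e, of n]
      linear_0[OF bounded_linear.linear[OF bounded_clinear_bounded_linear[OF T(3)]]]
    unfolding \<phi> by (metis norm_zero zero_neq_one)
  then have "Z_phi \<phi> \<beta> > 0"
    unfolding Z_phi_def using sumZ by (intro suminf_pos) (simp_all add: w_def)
  moreover
  {
    fix A B :: "'h \<Rightarrow> 'h"
    assume A: "bounded_clinear A" and B: "bounded_clinear B"
    define C where "C = cadjoint T \<circ> A \<circ> T"
    define D where "D = inv T \<circ> B \<circ> T"
    have C: "bounded_clinear C" and D: "bounded_clinear D"
      unfolding C_def D_def by (intro bounded_clinear_comp bounded_clinear_cadjoint[OF e] T A B)+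
    let ?X = "total_op A \<circ>\<^sub>m alpha_phi H0 T (\<i> * complex_of_real \<beta>) B"
    let ?Y = "total_op (twist T B \<circ> A)"
    define y where "y n = the (exp_op (- complex_of_real \<beta>) H0 (D (e n)))" for n
    have y_exp: "exp_op (- complex_of_real \<beta>) H0 x
        = Some (the (exp_op (- complex_of_real \<beta>) H0 x))" for x
      using exp_op_neg[OF e H \<beta>, of x] by (metis option.sel)
    have y_sums: "(\<lambda>m. (complex_of_real (w m) * cinner (e m) x) *\<^sub>C e m) sums
        the (exp_op (- complex_of_real \<beta>) H0 x)" for x
      using exp_op_neg[OF e H \<beta>, of x] unfolding w_def by (metis option.sel)
    \<comment> \<open>Homogeneity is read off the basis expansions. It lets the scalar created by
      the right-hand exponential pass through the left-hand one.\<close>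
    have y_scale: "the (exp_op (- complex_of_real \<beta>) H0 (c *\<^sub>C x))
        = c *\<^sub>C the (exp_op (- complex_of_real \<beta>) H0 x)" for c x
    proof -
      have "bounded_linear (\<lambda>v::'h. c *\<^sub>C v)"
        by (rule bounded_linear_intro[where K = "cmod c"])
          (simp_all add: scaleC_add_right scaleR_scaleC scaleC_scaleC norm_scaleC mult.commute)
      from bounded_linear.sums[OF this y_sums[of x]] y_sums[of "c *\<^sub>C x"]
      show ?thesis
        by (simp add: cinner_scaleC_right scaleC_scaleC mult_ac sums_unique2)
    qed
    \<comment> \<open>At imaginary time the right-hand exponential is the growing one, but it meets
      only \<open>inv T (\<phi> n) = e n\<close>; the left-hand one decays and is defined
      everywhere. Hence each \<open>\<phi> n\<close> lies in the domain of the product.\<close>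
    have X: "?X (\<phi> n) = Some (A (T (complex_of_real (exp (\<beta> * real n)) *\<^sub>C y n)))" for n
    proof -
      have "exp_op (complex_of_real \<beta>) H0 (e n)
          = Some (complex_of_real (exp (\<beta> * real n)) *\<^sub>C e n)"
        by (simp add: exp_op_basis[OF e H] flip: exp_of_real)
      moreover have "exp_op (- complex_of_real \<beta>) H0 (D (c *\<^sub>C e n)) = Some (c *\<^sub>C y n)" for c
        by (subst y_exp) (simp add: bounded_clinear_scaleC[OF D] y_scale y_def)
      ultimately show ?thesis
        by (simp add: alpha_phi_def alpha0_def map_comp_def total_op_def \<phi> D_def flip: mult.assoc)
    qed
    have X_term: "omega_term \<phi> \<beta> ?X n = cinner (e n) (C (y n))" for n
    proof -
      have "complex_of_real (exp (- \<beta> * real n)) * complex_of_real (exp (\<beta> * real n)) = 1"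
        by (simp flip: of_real_mult exp_add)
      then show ?thesis
        by (simp add: omega_term_def X[unfolded \<phi>] \<phi> C_def bounded_clinear_scaleC[OF T(1)]
            bounded_clinear_scaleC[OF A] cinner_scaleC_right cinner_cadjoint_right[OF e T(1)]
            flip: mult.assoc)
    qed
    have bij: "bij (T \<circ> cadjoint T)"
      by (rule bij_comp[OF bij_cadjoint[OF e T] T(2)])
    have Y_term: "omega_term \<phi> \<beta> ?Y n = complex_of_real (w n) * cinner (e n) (D (C (e n)))" for n
    proof -
      \<comment> \<open>Surjectivity of \<open>T \<circ> cadjoint T\<close> makes its
        \<open>inv\<close> a right inverse; applying \<open>inv T\<close> to that identity strips
        the outer \<open>T\<close>.\<close>
      have adj_inv: "cadjoint T (inv (T \<circ> cadjoint T) v) = inv T v" for v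
        using surj_f_inv_f[OF bij_is_surj[OF bij], of v] by (metis comp_apply inv_T(1))
      have "cinner (T (e n)) (twist T B v) = cinner (e n) (inv T (B (T (cadjoint T v))))" for v
        by (simp add: twist_def adj_inv flip: cinner_cadjoint_right[OF e T(1)])
      then show ?thesis
        by (simp add: omega_term_def total_op_def w_def \<phi> C_def D_def)
    qed
    note trace = trace_swap[OF e C D _ w, of y, unfolded y_def, OF _ y_sums, folded y_def]
    have w0: "w n \<ge> 0" for n by (simp add: w_def)
    obtain M where M: "\<And>x. norm (D (C x)) \<le> norm x * M"
      using bounded_linear.bounded[OF bounded_clinear_bounded_linear[OF bounded_clinear_comp[OF D C]]]
      by auto
    have X_defined: "omega_defined \<phi> \<beta> ?X"
      using trace(1)[OF w0] X by (auto simp: omega_defined_def X_term)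
    have Y_defined: "omega_defined \<phi> \<beta> ?Y"
    proof -
      have "summable (\<lambda>n. norm (omega_term \<phi> \<beta> ?Y n))"
      proof (rule summable_comparison_test'[OF summable_mult2[OF w, of M]])
        show "norm (norm (omega_term \<phi> \<beta> ?Y n)) \<le> w n * M" for n
          using Cauchy_Schwarz_cinner[of "e n" "D (C (e n))"] M[of "e n"] w0[of n]
          by (simp add: Y_term norm_mult orthonormal_basis_norm[OF e] mult_left_mono)
      qed
      then show ?thesis
        by (auto simp: omega_defined_def total_op_def)
    qed
    have eq: "omega \<phi> \<beta> ?X = omega \<phi> \<beta> ?Y"
      using trace(2)[OF w0] by (simp add: omega_def X_term Y_term)
    \<comment> \<open>Commutation places \<open>T \<circ> cadjoint T\<close> next to its inverse,
      where injectivity cancels the two.\<close>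
    have "twist T B = B" if "B \<circ> (T \<circ> cadjoint T) = (T \<circ> cadjoint T) \<circ> B"
      using that bij_is_inj[OF bij] unfolding twist_def
      by (metis comp_assoc id_comp inv_o_cancel)
    with X_defined Y_defined eq have "omega_defined \<phi> \<beta> ?X \<and> omega_defined \<phi> \<beta> ?Y \<and>
        omega \<phi> \<beta> ?X = omega \<phi> \<beta> ?Y \<and>
        (B \<circ> (T \<circ> cadjoint T) = (T \<circ> cadjoint T) \<circ> B \<longrightarrow>
          omega_defined \<phi> \<beta> (total_op (B \<circ> A)) \<and> omega \<phi> \<beta> (total_op (B \<circ> A)) = omega \<phi> \<beta> ?X)"
      by metis
  }
  ultimately show ?thesis
    using sumZ unfolding w_def by blast
qed

end
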